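(* Let $A\subset\mathbb{N}$ be a WM set. Then there exist $x,y,z\in A$ with $x\neq y$ and $xy=z^2$.
   Context: $\mathbb{N}=\{1,2,\dots\}$. $\Omega=\{0,1\}^{\mathbb{N}}$ with the product topology and the left shift $T$. For $S\subset\mathbb{N}$, $X_{1_S}$ is the closure of $\{T^n1_S:n\ge0\}$. A point $\xi$ is generic for $(X,\mu,T)$ if $\frac1N\sum_{n=0}^{N-1}f(T^n\xi)\to\int f\,d\mu$ for all continuous $f$. $d(S)=\lim_N\frac1N|S\cap\{1,\dots,N\}|$. $S$ is a WM set if for some $T$-invariant Borel probability $\mu$ on $X_{1_S}$, $1_S$ is generic for $(X_{1_S},\mu,T)$, this system is weakly mixing, and $d(S)>0$. *)

theory Defs
  imports "HOL-Probability.Probability"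
begin

text \<open>Omega = {0,1}^N with N = {1,2,...}, realized as nat \<Rightarrow> bool where
  coordinate i stands for the natural number i+1. The topology on nat \<Rightarrow> bool
  is the library's product topology (bool carries the discrete order topology).\<close>

type_synonym omega = "nat \<Rightarrow> bool"

definition shift :: "omega \<Rightarrow> omega" where
  "shift x = (\<lambda>i. x (Suc i))"

definition ind :: "nat set \<Rightarrow> omega" where
  "ind S = (\<lambda>i. Suc i \<in> S)"

definition orbit_closure :: "omega \<Rightarrow> omega set" where
  "orbit_closure \<xi> = closure (range (\<lambda>n. (shift ^^ n) \<xi>))"

definition shift_invariant :: "omega measure \<Rightarrow> bool" where
  "shift_invariant \<mu> \<longleftrightarrow> shift \<in> measurable \<mu> \<mu> \<and> distr \<mu> \<mu> shift = \<mu>"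

definition generic_point :: "omega set \<Rightarrow> omega measure \<Rightarrow> omega \<Rightarrow> bool" where
  "generic_point X \<mu> \<xi> \<longleftrightarrow>
     (\<forall>f :: omega \<Rightarrow> real. continuous_on X f \<longrightarrow>
        (\<lambda>N. (\<Sum>n<N. f ((shift ^^ n) \<xi>)) / real N) \<longlonglongrightarrow> integral\<^sup>L \<mu> f)"

definition weakly_mixing :: "omega measure \<Rightarrow> bool" where
  "weakly_mixing \<mu> \<longleftrightarrow> shift_invariant \<mu> \<and>
     (\<forall>A\<in>sets \<mu>. \<forall>B\<in>sets \<mu>.
        (\<lambda>N. (\<Sum>n<N. \<bar>measure \<mu> ((shift ^^ n) -` A \<inter> space \<mu> \<inter> B)
                        - measure \<mu> A * measure \<mu> B\<bar>) / real N) \<longlonglongrightarrow> 0)"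

definition has_density :: "nat set \<Rightarrow> real \<Rightarrow> bool" where
  "has_density S d \<longleftrightarrow> (\<lambda>N. real (card (S \<inter> {1..N})) / real N) \<longlonglongrightarrow> d"

definition WM_set :: "nat set \<Rightarrow> bool" where
  "WM_set S \<longleftrightarrow>
     (\<exists>\<mu>. sets \<mu> = sets (restrict_space borel (orbit_closure (ind S))) \<and>
          prob_space \<mu> \<and> shift_invariant \<mu> \<and>
          generic_point (orbit_closure (ind S)) \<mu> (ind S) \<and>
          weakly_mixing \<mu>) \<and>
     (\<exists>d>0. has_density S d)"

end

theory Submission
  imports Defs
begin

text \<open>Weak mixing makes the density of \<open>{n. q * n \<in> A}\<close> equal to that of \<open>A\<close> for every
  \<open>q > 0\<close>. Averaging over \<open>n\<close>, for each \<open>L\<close> some \<open>n\<close> has \<open>2 ^ k * n \<in> A\<close> for a positive proportion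
  of the exponents \<open>k < L\<close>. By Roth's theorem these exponents contain a non-trivial progression
  \<open>i, l, j\<close>, and \<open>2 ^ i * n\<close>, \<open>2 ^ l * n\<close>, \<open>2 ^ j * n\<close> is a geometric progression in \<open>A\<close>.

  Roth's theorem follows Szemeredi's combinatorial argument. If a progression-free \<open>A\<close> contains a
  cube \<open>a + cube ds\<close>, it misses every \<open>2 * z - a - s\<close> with \<open>z \<in> A\<close> and \<open>s \<in> cube ds\<close>. Along the
  suffixes of \<open>ds\<close> these missed sets grow inside a fixed interval, so one of them is almost
  invariant under some \<open>d\<close> in \<open>ds\<close>. Its complement then consists of few progressions of
  difference \<open>d\<close>, on which \<open>A\<close> cannot exceed the maximal density; this leaves too little of \<open>A\<close>.\<close>

section \<open>Roth's theorem\<close>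

definition progression_free :: "int set \<Rightarrow> bool" where
  "progression_free B \<longleftrightarrow> (\<forall>x\<in>B. \<forall>y\<in>B. \<forall>z\<in>B. x + y = 2 * z \<longrightarrow> x = y)"

text \<open>The constant \<open>K\<close> absorbs end effects, so the bound can be used on
  progressions of every length. The infimum of the admissible \<open>\<beta>\<close> is the upper
  limit of the maximal density of a progression-free subset of \<open>{0..<int L}\<close>.\<close>

definition linear_bound :: "real \<Rightarrow> real \<Rightarrow> bool" where
  "linear_bound \<beta> K \<longleftrightarrow>
     (\<forall>L::nat. \<forall>B\<subseteq>{0..<int L}. progression_free B \<longrightarrow> real (card B) \<le> \<beta> * L + K)"

lemma progression_free_subset: "progression_free B \<Longrightarrow> C \<subseteq> B \<Longrightarrow> progression_free C"
  unfolding progression_free_def by blast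

lemma linear_bound_nonneg:
  assumes "linear_bound \<beta> K"
  shows "K \<ge> 0"
proof -
  have "progression_free {}" by (simp add: progression_free_def)
  then show ?thesis
    using assms[unfolded linear_bound_def, rule_format, of "{}" 0] by simp
qed

text \<open>Progression-freeness is invariant under injective affine maps, so the indices
  \<open>i\<close> with \<open>x - i * d\<close> in \<open>A\<close> obey the bound themselves. The
  progression descends from \<open>x\<close> to match the peeling from the maximum in
  \<open>card_inter_le_runs\<close>.\<close>

lemma card_inter_progression_le:
  assumes "linear_bound \<beta> K" "progression_free A" "d > 0"
  shows "real (card (A \<inter> (\<lambda>i. x - i * d) ` {0..<int L})) \<le> \<beta> * L + K"
proof -
  define B where "B = {i\<in>{0..<int L}. x - i * d \<in> A}"
  have "progression_free B"
    unfolding progression_free_def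
  proof (intro ballI impI)
    fix a b c assume B: "a \<in> B" "b \<in> B" "c \<in> B" and "a + b = 2 * c"
    have "(x - a * d) + (x - b * d) = 2 * x - (a + b) * d" by (simp add: algebra_simps)
    also have "\<dots> = 2 * (x - c * d)" by (simp add: \<open>a + b = 2 * c\<close> algebra_simps)
    finally have "x - a * d = x - b * d"
      using B assms(2) unfolding B_def progression_free_def by blast
    then show "a = b" using \<open>d > 0\<close> by simp
  qed
  moreover have "B \<subseteq> {0..<int L}" by (auto simp: B_def)
  ultimately have "real (card B) \<le> \<beta> * L + K"
    using assms(1) unfolding linear_bound_def by blast
  moreover have "A \<inter> (\<lambda>i. x - i * d) ` {0..<int L} = (\<lambda>i. x - i * d) ` B"
    by (auto simp: B_def)
  moreover have "inj_on (\<lambda>i. x - i * d) B" using \<open>d > 0\<close> by (auto simp: inj_on_def)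
  ultimately show ?thesis by (simp add: card_image)
qed

text \<open>\<open>S\<close> splits into maximal progressions of difference \<open>d\<close>, each
  with exactly one top end, a point whose successor \<open>x + d\<close> is outside
  \<open>S\<close>. Each contributes \<open>\<beta>\<close> times its length plus one
  \<open>K\<close>. The induction removes the run that ends at \<open>Max S\<close>.\<close>

lemma card_inter_le_runs:
  assumes "linear_bound \<beta> K" "progression_free A" "d > 0" "finite S"
  shows "real (card (A \<inter> S)) \<le> \<beta> * card S + K * card {x\<in>S. x + d \<notin> S}"
  using \<open>finite S\<close>
proof (induction S rule: finite_psubset_induct)
  case (psubset S)
  show ?case
  proof (cases "S = {}")
    case False
    define x where "x = Max S"
    have x: "x \<in> S" "x + d \<notin> S"
      using False psubset.hyps \<open>d > 0\<close> Max_ge[of S "x + d"] by (auto simp: x_def)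
    have "\<exists>i. x - int i * d \<notin> S"
    proof (rule ccontr)
      assume "\<not> ?thesis"
      then have "range (\<lambda>i. x - int i * d) \<subseteq> S" by auto
      moreover have "inj (\<lambda>i. x - int i * d)" using \<open>d > 0\<close> by (auto simp: inj_def)
      ultimately show False
        using psubset.hyps finite_subset finite_imageD infinite_UNIV_nat by blast
    qed
    \<comment> \<open>\<open>L\<close> is the length of the run that descends from
      \<open>x\<close>.\<close>
    define L where "L = (LEAST i. x - int i * d \<notin> S)"
    have L: "x - int L * d \<notin> S" unfolding L_def by (rule LeastI_ex) fact
    have less_L: "x - int i * d \<in> S" if "i < L" for i
      using that not_less_Least unfolding L_def by blast
    have "L > 0" using L x(1) by (cases L) auto
    define P where "P = (\<lambda>i. x - i * d) ` {0..<int L}"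
    have P_S: "P \<subseteq> S"
    proof
      fix p assume "p \<in> P"
      then obtain i where "0 \<le> i" "i < int L" "p = x - i * d" by (auto simp: P_def)
      then show "p \<in> S" using less_L[of "nat i"] by simp
    qed
    have x_P: "x \<in> P" using \<open>L > 0\<close> by (auto simp: P_def intro!: image_eqI[of _ _ 0])
    have card_P: "card P = L"
      unfolding P_def using \<open>d > 0\<close> by (subst card_image) (auto simp: inj_on_def)
    have finP: "finite P" by (simp add: P_def)
    have pred: "y \<in> P" if "y \<in> S" "y + d \<in> P" for y
    proof -
      obtain i where i: "0 \<le> i" "i < int L" "y + d = x - i * d" using \<open>y + d \<in> P\<close> by (auto simp: P_def)
      then have y: "y = x - (i + 1) * d" by (simp add: algebra_simps)
      then have "i + 1 \<noteq> int L" using L \<open>y \<in> S\<close> by metis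
      then show ?thesis unfolding P_def using y i by (intro image_eqI[of _ _ "i + 1"]) auto
    qed
    \<comment> \<open>Removing the whole run turns no remaining point into a top end, since by
      \<open>pred\<close> no point of \<open>S\<close> outside \<open>P\<close> has its successor in
      \<open>P\<close>; the top end \<open>x\<close> disappears.\<close>
    have ends: "{y\<in>S - P. y + d \<notin> S - P} \<subseteq> {y\<in>S. y + d \<notin> S} - {x}"
      using pred x_P by auto
    have "card {y\<in>S - P. y + d \<notin> S - P} \<le> card ({y\<in>S. y + d \<notin> S} - {x})"
      using ends psubset.hyps by (intro card_mono) auto
    also have "\<dots> = card {y\<in>S. y + d \<notin> S} - 1"
      using x by (subst card_Diff_singleton) auto
    finally have e1: "card {y\<in>S - P. y + d \<notin> S - P} + 1 \<le> card {y\<in>S. y + d \<notin> S}"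
      using x psubset.hyps card_gt_0_iff[of "{y\<in>S. y + d \<notin> S}"] by fastforce
    have K: "K \<ge> 0" by (rule linear_bound_nonneg) fact
    have "real (card (A \<inter> (S - P))) \<le> \<beta> * card (S - P) + K * card {y\<in>S - P. y + d \<notin> S - P}"
      using P_S x_P by (intro psubset.IH) auto
    moreover have "K * card {y\<in>S - P. y + d \<notin> S - P} + K \<le> K * card {y\<in>S. y + d \<notin> S}"
    proof -
      have "real (card {y\<in>S - P. y + d \<notin> S - P}) + 1 \<le> card {y\<in>S. y + d \<notin> S}"
        using e1 by linarith
      from mult_left_mono[OF this K] show ?thesis by (simp add: algebra_simps)
    qed
    moreover have "real (card (A \<inter> P)) \<le> \<beta> * L + K"
      unfolding P_def by (rule card_inter_progression_le) fact+
    moreover have "card S = card (S - P) + L"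
      using P_S card_P psubset.hyps by (metis card_Diff_subset card_mono finP le_add_diff_inverse2)
    moreover have "card (A \<inter> S) \<le> card (A \<inter> (S - P)) + card (A \<inter> P)"
    proof -
      have "A \<inter> S \<subseteq> (A \<inter> (S - P)) \<union> (A \<inter> P)" by auto
      then have "card (A \<inter> S) \<le> card ((A \<inter> (S - P)) \<union> (A \<inter> P))"
        using psubset.hyps finP by (intro card_mono) auto
      then show ?thesis using card_Un_le le_trans by blast
    qed
    ultimately show ?thesis by (simp add: algebra_simps)
  qed simp
qed

lemma card_inter_interval_le:
  assumes "linear_bound \<beta> K" "progression_free A" "p \<le> q"
  shows "real (card (A \<inter> {p..<q})) \<le> \<beta> * of_int (q - p) + K"
proof -
  have "(\<lambda>i. q - 1 - i * 1) ` {0..<int (nat (q - p))} = {p..<q}"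
  proof (intro equalityI subsetI)
    fix y assume "y \<in> {p..<q}"
    then show "y \<in> (\<lambda>i. q - 1 - i * 1) ` {0..<int (nat (q - p))}"
      by (intro image_eqI[of _ _ "q - 1 - y"]) auto
  qed (use assms(3) in auto)
  then show ?thesis
    using card_inter_progression_le[OF assms(1,2), of 1 "q - 1" "nat (q - p)"] assms(3) by simp
qed

section \<open>Hilbert cubes in dense sets\<close>

fun cube :: "int list \<Rightarrow> int set" where
  "cube [] = {0}"
| "cube (d # ds) = cube ds \<union> (+) d ` cube ds"

lemma finite_cube: "finite (cube ds)"
  by (induction ds) auto

lemma zero_in_cube: "0 \<in> cube ds"
  by (induction ds) auto

text \<open>A cube consists of subset sums, and those of a suffix are the ones that omit the entries
  of \<open>es\<close>. Hence the missed sets of all suffixes avoid \<open>A\<close> as soon as the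
  full cube has a translate in \<open>A\<close>.\<close>

lemma cube_suffix: "cube ds \<subseteq> cube (es @ ds)"
  by (induction es) auto

text \<open>For points of \<open>B\<close> with no other point of \<open>B\<close> at distance at
  most \<open>q\<close> above them, the intervals of length \<open>q\<close> starting there are
  disjoint. So there are at most \<open>2 * m / q\<close> of them, which is at most half of
  \<open>\<delta> * m\<close>. The remaining points are distributed over \<open>q\<close>
  differences by pigeonhole.\<close>

lemma popular_difference:
  fixes m q :: nat and \<delta> :: real
  assumes B: "B \<subseteq> {0..<int m}" and \<delta>: "\<delta> * m \<le> card B" and q: "4 / \<delta> \<le> q" "q \<le> m" and "\<delta> > 0"
  shows "\<exists>d\<in>{1..int q}. \<delta> / (2 * q) * m \<le> card {b\<in>B. b + d \<in> B}"
proof -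
  have "q > 0" using q(1) \<open>\<delta> > 0\<close> by (metis divide_pos_pos gr0I less_le_not_le of_nat_0 zero_less_numeral)
  have finB: "finite B" using B finite_subset by blast
  define S where "S = {b\<in>B. \<forall>d\<in>{1..int q}. b + d \<notin> B}"
  have "inj_on (\<lambda>(b, j). b + j) (S \<times> {0..<int q})"
  proof -
    have False if "b \<in> S" "b' \<in> S" "i \<in> {0..<int q}" "j \<in> {0..<int q}" "b + i = b' + j" "b < b'" for b b' i j
    proof -
      have "b' = b + (i - j)" "i - j \<in> {1..int q}" using that by auto
      then show False using that(1,2) unfolding S_def by blast
    qed
    then have eq: "b = b'" if "b \<in> S" "b' \<in> S" "i \<in> {0..<int q}" "j \<in> {0..<int q}" "b + i = b' + j" for b b' i j
      using that linorder_neqE[of b b'] by metis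
    show ?thesis
    proof (rule inj_onI, clarify)
      fix b i b' j
      assume *: "b \<in> S" "i \<in> {0..<int q}" "b' \<in> S" "j \<in> {0..<int q}" "b + i = b' + j"
      from eq[OF *(1,3,2,4,5)] *(5) show "b = b' \<and> i = j" by simp
    qed
  qed
  then have "card (S \<times> {0..<int q}) = card ((\<lambda>(b, j). b + j) ` (S \<times> {0..<int q}))"
    by (simp add: card_image)
  also have "\<dots> \<le> card {0..<int (m + q)}"
  proof (intro card_mono subsetI)
    fix y assume "y \<in> (\<lambda>(b, j). b + j) ` (S \<times> {0..<int q})"
    then obtain b j where bj: "b \<in> S" "0 \<le> j" "j < int q" "y = b + j" by auto
    then have "b \<in> {0..<int m}" using B by (auto simp: S_def)
    with bj show "y \<in> {0..<int (m + q)}" by simp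
  qed simp
  finally have "card S * q \<le> m + q" by (simp add: card_cartesian_product)
  then have S: "real (card S) * q \<le> 2 * m"
    using \<open>q \<le> m\<close> by (simp flip: of_nat_mult of_nat_add add: of_nat_mono)
  have "card (B - S) \<le> (\<Sum>d\<in>{1..int q}. card {b\<in>B. b + d \<in> B})"
  proof -
    have "card (B - S) \<le> card (\<Union>d\<in>{1..int q}. {b\<in>B. b + d \<in> B})"
      using finB by (intro card_mono) (auto simp: S_def)
    then show ?thesis using card_UN_le[of "{1..int q}" "\<lambda>d. {b\<in>B. b + d \<in> B}"] by simp
  qed
  moreover have "card B = card (B - S) + card S"
    using finB by (metis (no_types, lifting) S_def card_Diff_subset card_mono finite_subset le_add_diff_inverse2 mem_Collect_eq subsetI)
  ultimately have 1: "real (card B) - card S \<le> (\<Sum>d\<in>{1..int q}. real (card {b\<in>B. b + d \<in> B}))"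
    by (simp flip: of_nat_sum)
  show ?thesis
  proof (rule ccontr)
    assume "\<not> ?thesis"
    then have lt: "real (card {b\<in>B. b + d \<in> B}) < \<delta> / (2 * q) * m" if "d \<in> {1..int q}" for d
      using that by (meson not_le)
    have "(\<Sum>d\<in>{1..int q}. real (card {b\<in>B. b + d \<in> B})) < (\<Sum>d\<in>{1..int q}. \<delta> / (2 * q) * m)"
      using \<open>q > 0\<close> lt by (intro sum_strict_mono) auto
    also have "\<dots> = \<delta> / 2 * m" using \<open>q > 0\<close> by simp
    finally have "card B - real (card S) < \<delta> / 2 * m" using 1 by simp
    then have "\<delta> / 2 * m < card S" using \<delta> by simp
    then have "\<delta> / 2 * m * q < card S * real q" using \<open>q > 0\<close> by simp
    with S have "\<delta> / 2 * m * q < 2 * m" by simp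
    moreover have "4 \<le> \<delta> * q" using q(1) \<open>\<delta> > 0\<close> by (simp add: field_simps)
    then have "4 * m \<le> \<delta> * q * m" by (simp add: mult_right_mono)
    ultimately show False by (simp add: algebra_simps)
  qed
qed

text \<open>Iteration of \<open>popular_difference\<close>: a cube inside
  \<open>{b\<in>B. b + d \<in> B}\<close> becomes a cube in \<open>B\<close> when \<open>d\<close>
  is prepended. \<open>D\<close> bounds the entries independently of \<open>m\<close>, which keeps
  the boundary loss of a later shift bounded as \<open>m\<close> grows.\<close>

lemma hilbert_cube:
  fixes \<delta> :: real
  assumes "\<delta> > 0"
  shows "\<exists>D::nat. \<forall>m\<ge>D. \<forall>B\<subseteq>{0..<int m}. \<delta> * m \<le> card B \<longrightarrow>
    (\<exists>a ds. length ds = k \<and> set ds \<subseteq> {1..int D} \<and> (+) a ` cube ds \<subseteq> B)"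
  using assms
proof (induction k arbitrary: \<delta>)
  case 0
  have nonempty: "\<exists>a. a \<in> B" if "m \<ge> 1" "\<delta> * m \<le> card B" for m :: nat and B :: "int set"
  proof (rule ccontr)
    assume "\<not> ?thesis"
    then have "\<delta> * m \<le> 0" using that by auto
    then show False using 0 that(1) by (simp add: mult_le_0_iff)
  qed
  have singleton: "\<exists>a ds. length ds = 0 \<and> set ds \<subseteq> {1..int 1} \<and> (+) a ` cube ds \<subseteq> B"
    if "m \<ge> 1" "\<delta> * m \<le> card B" for m :: nat and B :: "int set"
  proof -
    from nonempty[OF that] obtain a where "a \<in> B" ..
    then show ?thesis by (intro exI[of _ a] exI[of _ "[]"]) simp
  qed
  \<comment> \<open>With \<open>D = 1\<close> the interval is nonempty, so positive density yields a
    point, and a point is a translate of \<open>cube []\<close>.\<close>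
  show ?case by (rule exI[of _ 1], intro allI impI, rule singleton)
next
  case (Suc k)
  define q where "q = nat \<lceil>4 / \<delta>\<rceil>"
  have q: "4 / \<delta> \<le> q" unfolding q_def by linarith
  then have "q > 0" using \<open>\<delta> > 0\<close> by (metis divide_pos_pos gr0I less_le_not_le of_nat_0 zero_less_numeral)
  have "\<delta> / (2 * q) > 0" using \<open>\<delta> > 0\<close> \<open>q > 0\<close> by simp
  from Suc.IH[OF this] obtain D where
    D: "\<forall>m\<ge>D. \<forall>B\<subseteq>{0..<int m}. \<delta> / (2 * q) * m \<le> card B \<longrightarrow>
      (\<exists>a ds. length ds = k \<and> set ds \<subseteq> {1..int D} \<and> (+) a ` cube ds \<subseteq> B)" ..
  show ?case
  proof (intro exI[of _ "max D q"] allI impI)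
    fix m B assume m: "max D q \<le> m" and B: "B \<subseteq> {0..<int m}" "\<delta> * m \<le> card B"
    obtain d where d: "d \<in> {1..int q}" "\<delta> / (2 * q) * m \<le> card {b\<in>B. b + d \<in> B}"
      using popular_difference[OF B q _ \<open>\<delta> > 0\<close>] m by (meson max.boundedE)
    obtain a ds where a: "length ds = k" "set ds \<subseteq> {1..int D}" "(+) a ` cube ds \<subseteq> {b\<in>B. b + d \<in> B}"
    proof -
      have "{b\<in>B. b + d \<in> B} \<subseteq> {0..<int m}" using B by blast
      then show thesis using D m d(2) that by (meson max.boundedE)
    qed
    have "a + s \<in> B" "a + (d + s) \<in> B" if "s \<in> cube ds" for s
    proof -
      have "a + s \<in> {b\<in>B. b + d \<in> B}" using a(3) that by blast
      then show "a + s \<in> B" "a + (d + s) \<in> B" by (simp_all add: algebra_simps)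
    qed
    then have "(+) a ` cube (d # ds) \<subseteq> B" by auto
    then show "\<exists>a ds. length ds = Suc k \<and> set ds \<subseteq> {1..int (max D q)} \<and> (+) a ` cube ds \<subseteq> B"
      using a(1,2) d(1) by (intro exI[of _ a] exI[of _ "d # ds"]) fastforce
  qed
qed

text \<open>The enlargements along the suffixes of \<open>ds\<close> add up to at most \<open>card (N ds)\<close>.\<close>

lemma ex_almost_invariant_suffix:
  fixes N :: "int list \<Rightarrow> int set" and t :: real
  assumes N: "\<And>d ds. N (d # ds) = N ds \<union> (\<lambda>x. x - d) ` N ds"
    and fin: "\<And>ds. finite (N ds)"
    and "real (card (N ds)) \<le> t * length ds" "ds \<noteq> []"
  shows "\<exists>es d ds'. ds = es @ d # ds' \<and> real (card ((\<lambda>x. x - d) ` N ds' - N ds')) \<le> t"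
proof (rule ccontr)
  assume contra: "\<not> ?thesis"
  \<comment> \<open>If every shift added more than \<open>t\<close> points, the growth would
    accumulate along the suffixes. Strictness for nonempty suffixes is needed because the assumed
    bound \<open>t * length ds\<close> may be attained.\<close>
  have "t * length bs + card (N []) \<le> card (N bs) \<and> (bs \<noteq> [] \<longrightarrow> t * length bs + card (N []) < card (N bs))"
    if "ds = as @ bs" for as bs
    using that
  proof (induction bs arbitrary: as)
    case (Cons d bs)
    have "t < real (card ((\<lambda>x. x - d) ` N bs - N bs))"
      using contra Cons.prems by (auto simp: not_le)
    moreover have "card (N (d # bs)) = card (N bs) + card ((\<lambda>x. x - d) ` N bs - N bs)"
      unfolding N using fin by (subst card_Un_disjoint[symmetric]) auto
    moreover have "t * length bs + card (N []) \<le> card (N bs)"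
      using Cons.IH[of "as @ [d]"] Cons.prems by simp
    ultimately show ?case by (auto simp: algebra_simps)
  qed simp
  from this[of "[]" ds] assms(3,4) show False by auto
qed


section \<open>Lowering the density\<close>

text \<open>The missed set contains a reflected copy of the part \<open>Z\<close> of
  \<open>A\<close>, hence at least \<open>\<beta> * m / 2\<close> points, and each missed point
  lowers the bound by \<open>\<beta>\<close>. This gain of \<open>\<beta>\<^sup>2 * m / 2\<close>
  beats two end costs of at most \<open>\<beta>\<^sup>2 * m / 8\<close> each and the deficit
  \<open>4 * (\<epsilon> * m)\<close>, again \<open>\<beta>\<^sup>2 * m / 8\<close>.\<close>

lemma roth_increment:
  assumes lb: "linear_bound \<beta> K" and "0 < \<beta>" "\<beta> \<le> 1"
  shows "\<exists>K'. linear_bound (\<beta> - \<beta>\<^sup>2 / 32) K'"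
proof -
  have "K \<ge> 0" by (rule linear_bound_nonneg) fact
  define \<epsilon> where "\<epsilon> = \<beta>\<^sup>2 / 32"
  have \<beta>2: "0 < \<beta>\<^sup>2" "\<beta>\<^sup>2 \<le> \<beta>"
    using assms(2,3) by (auto simp: power2_eq_square mult_le_cancel_left1)
  then have \<epsilon>: "0 < \<epsilon>" "\<epsilon> \<le> \<beta> / 32" by (auto simp: \<epsilon>_def)
  \<comment> \<open>Long enough that \<open>K * t\<close>, with \<open>t = 3 * m / k\<close> below,
    costs at most \<open>\<beta>\<^sup>2 * m / 8\<close>.\<close>
  define k where "k = Suc (nat \<lceil>24 * K / \<beta>\<^sup>2\<rceil>)"
  have "24 * K / \<beta>\<^sup>2 \<le> k" unfolding k_def by linarith
  then have k: "24 * K \<le> \<beta>\<^sup>2 * k" using \<beta>2 by (simp add: field_simps)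
  have "k > 0" by (simp add: k_def)
  obtain D :: nat where D: "\<And>m B. m \<ge> D \<Longrightarrow> B \<subseteq> {0..<int m} \<Longrightarrow> \<beta> / 2 * m \<le> card B \<Longrightarrow>
      \<exists>a ds. length ds = k \<and> set ds \<subseteq> {1..int D} \<and> (+) a ` cube ds \<subseteq> B"
    using hilbert_cube[of "\<beta> / 2" k] \<open>\<beta> > 0\<close> by (metis half_gt_zero)
  \<comment> \<open>Large enough that a counterexample has \<open>m\<close> above
    \<open>D + 8 * K * D / \<beta>\<^sup>2\<close>, and that \<open>2 * K\<close> survives the loss
    of up to three points when \<open>L\<close> is rounded down to \<open>4 * m\<close>.\<close>
  define K' where "K' = 2 * K + 4 * (D + 8 * K * D / \<beta>\<^sup>2) + 7"
  have "8 * K * D / \<beta>\<^sup>2 \<ge> 0" using \<open>K \<ge> 0\<close> by simp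
  then have "2 * K + 3 \<le> K'" unfolding K'_def by (simp add: add_nonneg_nonneg)
  have "linear_bound (\<beta> - \<epsilon>) K'"
    unfolding linear_bound_def
  proof (intro allI impI, rule ccontr)
    fix L :: nat and B
    assume B: "B \<subseteq> {0..<int L}" and pfB: "progression_free B"
      and "\<not> real (card B) \<le> (\<beta> - \<epsilon>) * L + K'"
    then have cB: "(\<beta> - \<epsilon>) * L + K' < card B" by simp
    define m where "m = L div 4"
    have m: "4 * m \<le> L" "L \<le> 4 * m + 3" unfolding m_def by auto
    have "card B \<le> L" using card_mono[OF _ B] by simp
    moreover have "(\<beta> - \<epsilon>) * L \<ge> 0" using \<epsilon> by simp
    ultimately have "K' < L" using cB by linarith
    then have "K' < 4 * real m + 3" using m(2) by linarith
    then have "D + 8 * K * D / \<beta>\<^sup>2 < m" using \<open>K \<ge> 0\<close> unfolding K'_def by simp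
    then have "m \<ge> D" "m > 0" "8 * K * D / \<beta>\<^sup>2 \<le> m"
      using \<open>8 * K * D / \<beta>\<^sup>2 \<ge> 0\<close> by linarith+
    then have mD: "8 * K * D \<le> \<beta>\<^sup>2 * m" using \<beta>2 by (simp add: field_simps)
    define A where "A = B \<inter> {0..<4 * int m}"
    have pfA: "progression_free A"
      unfolding A_def using pfB by (rule progression_free_subset) auto
    have A_sub: "A \<subseteq> {0..<4 * int m}" by (auto simp: A_def)
    then have finA: "finite A" using finite_subset by blast
    have "card B \<le> card (A \<union> {4 * int m..<int L})"
      using B finA by (intro card_mono) (auto simp: A_def)
    also have "\<dots> \<le> card A + 3" using card_Un_le[of A "{4 * int m..<int L}"] m by simp
    finally have "real (card B) \<le> card A + 3" by linarith
    moreover have "(\<beta> - \<epsilon>) * (4 * m) \<le> (\<beta> - \<epsilon>) * L"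
      using m \<epsilon> by (intro mult_left_mono) auto
    ultimately have cA: "4 * (\<beta> - \<epsilon>) * m + 2 * K \<le> card A"
      using cB \<open>2 * K + 3 \<le> K'\<close> by (simp only: mult.assoc mult.left_commute[of "\<beta> - \<epsilon>" 4])
    \<comment> \<open>The cube is found in the first quarter and reflected in points of the second:
      for \<open>x\<close> in \<open>A0\<close> and \<open>z\<close> in \<open>Z\<close>, the point
      \<open>2 * z - x\<close> lies in \<open>{int m..<4 * int m}\<close> and differs from
      \<open>x\<close>.\<close>
    define A0 where "A0 = A \<inter> {0..<int m}"
    define Z where "Z = A \<inter> {int m..<2 * int m}"
    define Y where "Y = A \<inter> {2 * int m..<4 * int m}"
    have cards: "card A = card A0 + card Z + card Y"
    proof -
      have "A = A0 \<union> Z \<union> Y" using A_sub by (auto simp: A0_def Z_def Y_def)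
      moreover have "card (A0 \<union> Z \<union> Y) = card (A0 \<union> Z) + card Y"
        using finA by (intro card_Un_disjoint) (auto simp: A0_def Z_def Y_def)
      moreover have "card (A0 \<union> Z) = card A0 + card Z"
        using finA by (intro card_Un_disjoint) (auto simp: A0_def Z_def)
      ultimately show ?thesis by simp
    qed
    have ZY: "card (A \<inter> {int m..<4 * int m}) = card Z + card Y"
    proof -
      have "A \<inter> {int m..<4 * int m} = Z \<union> Y" by (auto simp: Z_def Y_def)
      then show ?thesis
        using finA by (auto intro!: card_Un_disjoint simp: Z_def Y_def)
    qed
    have up: "card A0 \<le> \<beta> * m + K" "card Z \<le> \<beta> * m + K" "card Y \<le> \<beta> * (2 * m) + K"
      "card Z + card Y \<le> \<beta> * (3 * m) + K"
      using card_inter_interval_le[OF lb pfA, of 0 "int m"] card_inter_interval_le[OF lb pfA, of "int m" "2 * int m"]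
        card_inter_interval_le[OF lb pfA, of "2 * int m" "4 * int m"] card_inter_interval_le[OF lb pfA, of "int m" "4 * int m"]
      by (auto simp: A0_def Z_def Y_def ZY)
    \<comment> \<open>Since each block obeys its upper bound in \<open>up\<close>, a nearly extremal
      total forces \<open>A0\<close> and \<open>Z\<close> to be nearly extremal as well.\<close>
    have cA': "4 * (\<beta> * m) - 4 * (\<epsilon> * m) + 2 * K \<le> real (card A0) + card Z + card Y"
      using cA cards by (simp add: algebra_simps)
    have em: "\<epsilon> * m \<le> \<beta> * m / 32" using mult_right_mono[OF \<epsilon>(2), of "real m"] by simp
    have bm: "\<beta> * m > 0" using \<open>\<beta> > 0\<close> \<open>m > 0\<close> by simp
    have "\<beta> / 2 * m \<le> card A0" using cA' up em bm \<open>K \<ge> 0\<close> by simp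
    then obtain a ds where ds: "length ds = k" "set ds \<subseteq> {1..int D}" "(+) a ` cube ds \<subseteq> A0"
      using D[OF \<open>m \<ge> D\<close>, of A0] by (auto simp: A0_def)
    \<comment> \<open>These are the points completing a progression that starts in the translated
      cube and has its middle in \<open>Z\<close>.\<close>
    define N where "N ds = (\<lambda>(z, s). 2 * z - a - s) ` (Z \<times> cube ds)" for ds
    have finN: "finite (N ds)" for ds
      using finA by (simp add: N_def finite_cube Z_def)
    have N_Cons: "N (d # ds) = N ds \<union> (\<lambda>x. x - d) ` N ds" for d ds
    proof -
      have "N (d # ds) = N ds \<union> (\<lambda>(z, s). 2 * z - a - s) ` (Z \<times> (+) d ` cube ds)"
        by (simp add: N_def Sigma_Un_distrib2 image_Un)
      also have "(\<lambda>(z, s). 2 * z - a - s) ` (Z \<times> (+) d ` cube ds) = (\<lambda>x. x - d) ` N ds"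
      proof -
        have "Z \<times> (+) d ` cube ds = (\<lambda>(z, s). (z, d + s)) ` (Z \<times> cube ds)" by auto
        then show ?thesis
          by (simp only: N_def image_image case_prod_unfold fst_conv snd_conv) (simp add: algebra_simps)
      qed
      finally show ?thesis .
    qed
    have N_sub: "N ds' \<subseteq> {int m..<4 * int m} - A" if "ds = es @ ds'" for es ds'
    proof
      fix y assume "y \<in> N ds'"
      then obtain z s where zs: "z \<in> Z" "s \<in> cube ds'" "y = 2 * z - a - s" by (auto simp: N_def)
      have "a + s \<in> A0" using ds(3) zs(2) cube_suffix[of ds' es] that by auto
      then have x: "a + s \<in> A" "0 \<le> a + s" "a + s < m" by (auto simp: A0_def)
      have z: "z \<in> A" "int m \<le> z" "z < 2 * int m" using zs(1) by (auto simp: Z_def)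
      have "y \<notin> A"
      proof
        assume "y \<in> A"
        moreover have "(a + s) + y = 2 * z" using zs(3) by simp
        ultimately have "a + s = y" using pfA x(1) z(1) unfolding progression_free_def by blast
        then show False using x z zs(3) by simp
      qed
      then show "y \<in> {int m..<4 * int m} - A" using zs(3) x z by auto
    qed
    define t where "t = 3 * m / k"
    have "card (N ds) \<le> card {int m..<4 * int m}"
      using N_sub[of "[]" ds] by (intro card_mono) auto
    then have "real (card (N ds)) \<le> t * length ds" using ds(1) \<open>k > 0\<close> by (simp add: t_def)
    moreover have "ds \<noteq> []" using ds(1) \<open>k > 0\<close> by auto
    ultimately obtain es d ds' where split: "ds = es @ d # ds'"
      and t: "real (card ((\<lambda>x. x - d) ` N ds' - N ds')) \<le> t"
      using ex_almost_invariant_suffix[of N ds t, OF N_Cons finN] by blast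
    have d: "1 \<le> d" "d \<le> int D" using ds(2) split by auto
    define S where "S = {int m..<4 * int m} - N ds'"
    have N': "N ds' \<subseteq> {int m..<4 * int m} - A" using N_sub[of "es @ [d]" ds'] split by simp
    have AS: "A \<inter> S = A \<inter> {int m..<4 * int m}" using N' by (auto simp: S_def)
    \<comment> \<open>A run of \<open>S\<close> breaks off either at the right end of the interval,
      at most \<open>d\<close> times, or by stepping into \<open>N ds'\<close>, which happens only
      at points newly covered when \<open>N ds'\<close> is shifted by \<open>d\<close>.\<close>
    have "{x\<in>S. x + d \<notin> S} \<subseteq> {4 * int m - d..<4 * int m} \<union> ((\<lambda>x. x - d) ` N ds' - N ds')"
    proof
      fix x assume x: "x \<in> {x\<in>S. x + d \<notin> S}"
      show "x \<in> {4 * int m - d..<4 * int m} \<union> ((\<lambda>x. x - d) ` N ds' - N ds')"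
      proof (cases "x + d < 4 * int m")
        case True
        then have "x + d \<in> N ds'" "x \<notin> N ds'" using x d by (auto simp: S_def)
        then show ?thesis using image_eqI[of x "\<lambda>x. x - d" "x + d"] by simp
      qed (use x d in \<open>auto simp: S_def\<close>)
    qed
    then have "card {x\<in>S. x + d \<notin> S} \<le> card ({4 * int m - d..<4 * int m} \<union> ((\<lambda>x. x - d) ` N ds' - N ds'))"
      using finN by (intro card_mono) auto
    also have "\<dots> \<le> nat d + card ((\<lambda>x. x - d) ` N ds' - N ds')"
      using card_Un_le[of "{4 * int m - d..<4 * int m}"] by simp
    finally have ends: "real (card {x\<in>S. x + d \<notin> S}) \<le> D + t" using t d by linarith
    have cS: "real (card S) = 3 * m - real (card (N ds'))"
    proof -
      have "card S = card {int m..<4 * int m} - card (N ds')"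
        unfolding S_def using N' finN by (intro card_Diff_subset) auto
      moreover have "card (N ds') \<le> card {int m..<4 * int m}"
        using N' by (intro card_mono) auto
      ultimately show ?thesis by (simp add: of_nat_diff)
    qed
    have "card Z = card ((\<lambda>z. 2 * z - a - 0) ` Z)" by (subst card_image) (auto simp: inj_on_def)
    also have "\<dots> \<le> card (N ds')"
    proof (intro card_mono finN image_subsetI)
      fix z assume "z \<in> Z"
      then show "2 * z - a - 0 \<in> N ds'"
        unfolding N_def using zero_in_cube by (intro image_eqI[of _ _ "(z, 0)"]) auto
    qed
    finally have ZN: "real (card Z) \<le> card (N ds')" by simp
    have "real (card Z + card Y) \<le> \<beta> * card S + K * card {x\<in>S. x + d \<notin> S}"
      using card_inter_le_runs[OF lb pfA, of d S] d AS ZY by (simp add: S_def)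
    also have "\<dots> \<le> \<beta> * (3 * real m - real (card Z)) + K * (D + t)"
      using cS ZN ends \<open>\<beta> > 0\<close> \<open>K \<ge> 0\<close> by (intro add_mono mult_left_mono) auto
    finally have main: "card Z + card Y \<le> \<beta> * (3 * m) - \<beta> * card Z + K * D + K * t"
      by (simp add: algebra_simps)
    have Kt: "8 * (K * t) \<le> \<beta>\<^sup>2 * m"
    proof -
      have "8 * (K * t) = (24 * K) * (m / k)" by (simp add: t_def)
      also have "\<dots> \<le> (\<beta>\<^sup>2 * k) * (m / k)" using k by (intro mult_right_mono) auto
      also have "\<dots> = \<beta>\<^sup>2 * m" using \<open>k > 0\<close> by simp
      finally show ?thesis .
    qed
    have Zlow: "\<beta> * m / 2 \<le> card Z" using cA' up em bm by simp
    have "\<beta> * (\<beta> * m / 2) \<le> \<beta> * card Z" using Zlow \<open>\<beta> > 0\<close> by (intro mult_left_mono) auto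
    then have bZ: "\<beta>\<^sup>2 * m / 2 \<le> \<beta> * card Z" by (simp add: power2_eq_square)
    have "\<beta>\<^sup>2 * m > 0" using \<beta>2 \<open>m > 0\<close> by simp
    moreover have "4 * (\<epsilon> * m) = \<beta>\<^sup>2 * m / 8" by (simp add: \<epsilon>_def)
    ultimately show False using main Kt bZ mD cA' up(1) \<open>K \<ge> 0\<close> by simp
  qed
  then show ?thesis unfolding \<epsilon>_def by blast
qed

text \<open>The infimum \<open>c\<close> of the admissible densities is zero: otherwise some
  admissible value lies below \<open>c + c\<^sup>2 / 32\<close>, and \<open>roth_increment\<close>
  leads from it below \<open>c\<close>. With an admissible \<open>\<beta> < \<delta>\<close>, any
  \<open>L\<close> with \<open>K < L * (\<delta> - \<beta>)\<close> serves.\<close>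

theorem roth:
  fixes \<delta> :: real
  assumes "\<delta> > 0"
  shows "\<exists>L>0. \<forall>B\<subseteq>{0..<int L}. \<delta> * L \<le> card B \<longrightarrow> \<not> progression_free B"
proof -
  define G where "G = {\<beta>. \<exists>K. linear_bound \<beta> K}"
  have nonneg: "\<beta> \<ge> 0" if "\<beta> \<in> G" for \<beta>
  proof (rule ccontr)
    assume "\<not> ?thesis"
    from that obtain K where K: "linear_bound \<beta> K" by (auto simp: G_def)
    have "progression_free {}" by (simp add: progression_free_def)
    then have "0 \<le> \<beta> * n + K" for n :: nat
      using K[unfolded linear_bound_def, rule_format, of "{}" n] by simp
    moreover obtain n :: nat where "K < n * (- \<beta>)"
      using reals_Archimedean3[of "- \<beta>"] \<open>\<not> \<beta> \<ge> 0\<close> by auto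
    ultimately show False by (smt (verit) mult.commute mult_minus_right)
  qed
  have "linear_bound 1 0"
    unfolding linear_bound_def
  proof (intro allI impI)
    fix L :: nat and B assume "B \<subseteq> {0..<int L}"
    then have "card B \<le> card {0..<int L}" by (intro card_mono) auto
    then show "card B \<le> 1 * real L + 0" by simp
  qed
  then have "1 \<in> G" by (auto simp: G_def)
  have bdd: "bdd_below G" using nonneg by (auto simp: bdd_below_def)
  have "Inf G \<le> 1" using \<open>1 \<in> G\<close> bdd by (rule cInf_lower)
  have "Inf G \<ge> 0" using \<open>1 \<in> G\<close> nonneg by (intro cInf_greatest) auto
  have "Inf G = 0"
  proof (rule ccontr)
    assume "Inf G \<noteq> 0"
    define c where "c = Inf G"
    have "c > 0" using \<open>Inf G \<noteq> 0\<close> \<open>Inf G \<ge> 0\<close> by (simp add: c_def)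
    then have "Inf G < c + c\<^sup>2 / 32" by (simp add: c_def)
    then obtain \<beta> where \<beta>: "\<beta> \<in> G" "\<beta> < c + c\<^sup>2 / 32" 
      using cInf_lessD[of G] \<open>1 \<in> G\<close> by blast
    \<comment> \<open>Truncation at 1 stays in \<open>G\<close> and meets the hypothesis
      \<open>\<beta> \<le> 1\<close> of \<open>roth_increment\<close>.\<close>
    define \<beta>' where "\<beta>' = min \<beta> 1"
    have "\<beta>' \<in> G" using \<beta> \<open>1 \<in> G\<close> by (simp add: \<beta>'_def min_def)
    have "c \<le> \<beta>'" unfolding c_def using \<open>\<beta>' \<in> G\<close> bdd by (rule cInf_lower)
    then have "\<beta>' - \<beta>'\<^sup>2 / 32 \<in> G"
      using roth_increment[of \<beta>'] \<open>\<beta>' \<in> G\<close> \<open>c > 0\<close> by (auto simp: G_def \<beta>'_def)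
    then have "c \<le> \<beta>' - \<beta>'\<^sup>2 / 32" unfolding c_def using bdd by (rule cInf_lower)
    moreover have "c\<^sup>2 \<le> \<beta>'\<^sup>2" using \<open>c \<le> \<beta>'\<close> \<open>c > 0\<close> by (intro power_mono) auto
    moreover have "\<beta>' \<le> \<beta>" by (simp add: \<beta>'_def)
    ultimately show False using \<beta>(2) by simp
  qed
  then obtain \<beta> where "\<beta> \<in> G" "\<beta> < \<delta>"
    using cInf_lessD[of G \<delta>] \<open>1 \<in> G\<close> assms by auto
  then obtain K where K: "linear_bound \<beta> K" by (auto simp: G_def)
  obtain L :: nat where L: "K < L * (\<delta> - \<beta>)"
    using reals_Archimedean3[of "\<delta> - \<beta>"] \<open>\<beta> < \<delta>\<close> by auto
  have "L > 0" using L linear_bound_nonneg[OF K] by (cases L) auto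
  moreover have "\<not> progression_free B" if "B \<subseteq> {0..<int L}" "\<delta> * L \<le> card B" for B
  proof
    assume "progression_free B"
    then have "card B \<le> \<beta> * L + K" using K that(1) unfolding linear_bound_def by blast
    then show False using that(2) L by (simp add: algebra_simps)
  qed
  ultimately show ?thesis by blast
qed

section \<open>Dilates of weakly mixing sets\<close>

lemma shift_funpow: "(shift ^^ n) x i = x (n + i)"
  by (induction n arbitrary: i) (simp_all add: shift_def)

definition centred :: "real \<Rightarrow> nat \<Rightarrow> omega \<Rightarrow> real" where
  "centred d i x = of_bool (x i) - d"

lemma continuous_on_coordinate: "continuous_on S (\<lambda>x::omega. of_bool (x i) :: real)"
  by (rule continuous_on_compose2[of UNIV of_bool S "\<lambda>x. x i"])
     (auto intro: continuous_on_product_coordinates continuous_on_subset)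

lemma continuous_on_centred [continuous_intros]: "continuous_on S (centred d i)"
  unfolding centred_def by (intro continuous_intros continuous_on_coordinate)

locale wm_system = prob_space \<mu> for \<mu> :: "omega measure" +
  fixes A :: "nat set" and d :: real
  assumes sets_\<mu>: "sets \<mu> = sets (restrict_space borel (orbit_closure (ind A)))"
    and invariant: "shift_invariant \<mu>"
    and generic: "generic_point (orbit_closure (ind A)) \<mu> (ind A)"
    and weakly_mixing: "weakly_mixing \<mu>"
    and d_pos: "d > 0"
    and density: "has_density A d"
begin

abbreviation X :: "omega set" where "X \<equiv> orbit_closure (ind A)"

lemma space_eq: "space \<mu> = X"
  using sets_eq_imp_space_eq[OF sets_\<mu>] by (simp add: space_restrict_space)

lemma measurable_continuous:
  fixes f :: "omega \<Rightarrow> real"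
  assumes "continuous_on X f"
  shows "f \<in> borel_measurable \<mu>"
  using borel_measurable_continuous_on_restrict[OF assms] measurable_cong_sets[OF sets_\<mu> refl]
  by blast

lemma generic_tendsto:
  fixes f :: "omega \<Rightarrow> real"
  assumes "continuous_on X f"
  shows "(\<lambda>N. (\<Sum>n<N. f ((shift ^^ n) (ind A))) / real N) \<longlonglongrightarrow> integral\<^sup>L \<mu> f"
  using generic assms unfolding generic_point_def by blast

lemma shift_measurable: "shift \<in> measurable \<mu> \<mu>"
  and distr_shift: "distr \<mu> \<mu> shift = \<mu>"
  using invariant by (auto simp: shift_invariant_def)

lemma integral_shift:
  fixes f :: "omega \<Rightarrow> real"
  assumes "f \<in> borel_measurable \<mu>"
  shows "(\<integral>x. f (shift x) \<partial>\<mu>) = integral\<^sup>L \<mu> f"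
  using integral_distr[OF shift_measurable assms] by (simp add: distr_shift)

lemma integrable_bounded_continuous:
  fixes f :: "omega \<Rightarrow> real"
  assumes "continuous_on X f" "\<And>x. \<bar>f x\<bar> \<le> B"
  shows "integrable \<mu> f"
  using assms by (intro integrable_const_bound[of _ B] measurable_continuous) auto

lemma integrable_coordinates:
  "integrable \<mu> (\<lambda>x. of_bool (x i) * of_bool (x j) :: real)"
  "integrable \<mu> (\<lambda>x. of_bool (x i) :: real)"
  by (rule integrable_bounded_continuous[of _ 1];
      force intro!: continuous_intros continuous_on_coordinate)+

lemma abs_centred_le: "\<bar>centred d i x\<bar> \<le> 1 + d"
  using d_pos by (auto simp: centred_def)

lemma integrable_centred_mult: "integrable \<mu> (\<lambda>x. centred d i x * centred d j x)"
  by (rule integrable_bounded_continuous[of _ "(1 + d) * (1 + d)"])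
     (auto intro!: continuous_intros mult_mono abs_centred_le simp: abs_mult abs_ge_zero d_pos less_imp_le add_nonneg_nonneg)

text \<open>Genericity tested on coordinate 0 gives the counting frequency of \<open>A\<close>, as
  this coordinate of \<open>(shift ^^ n) (ind A)\<close> records \<open>Suc n \<in> A\<close>.
  Invariance carries the value to the other coordinates.\<close>

lemma integral_coordinate: "(\<integral>x. of_bool (x i) \<partial>\<mu>) = d"
proof (induction i)
  case 0
  have "(\<Sum>n<N. of_bool ((shift ^^ n) (ind A) 0)) = real (card (A \<inter> {1..N}))" for N
  proof -
    have "(\<Sum>n<N. of_bool ((shift ^^ n) (ind A) 0)) = (\<Sum>n<N. of_bool (Suc n \<in> A) :: real)"
      by (simp add: shift_funpow ind_def)
    also have "\<dots> = (\<Sum>n\<in>{1..N}. of_bool (n \<in> A))"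
      by (rule sum.reindex_bij_witness[of _ "\<lambda>n. n - 1" Suc]) auto
    also have "\<dots> = real (card (A \<inter> {1..N}))"
      by (simp add: of_bool_def sum.If_cases Int_def conj_commute)
    finally show ?thesis .
  qed
  then have "(\<lambda>N. real (card (A \<inter> {1..N})) / real N) \<longlonglongrightarrow> (\<integral>x. of_bool (x 0) \<partial>\<mu>)"
    using generic_tendsto[OF continuous_on_coordinate[of _ 0]] by simp
  with density show ?case unfolding has_density_def using LIMSEQ_unique by blast
next
  case (Suc i)
  have "(\<integral>x. (of_bool (shift x i) :: real) \<partial>\<mu>) = (\<integral>x. of_bool (x i) \<partial>\<mu>)"
    by (rule integral_shift) (intro measurable_continuous continuous_on_coordinate)
  with Suc show ?case by (simp add: shift_def)
qed

section \<open>Autocovariances of the coordinate process\<close>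

definition correlation :: "nat \<Rightarrow> real" where
  "correlation h = (\<integral>x. centred d 0 x * centred d h x \<partial>\<mu>)"

text \<open>Invariance lowers both indices together until the first is 0, so only their difference
  matters.\<close>

lemma integral_centred_mult_le:
  assumes "i \<le> j"
  shows "(\<integral>x. centred d i x * centred d j x \<partial>\<mu>) = correlation (j - i)"
  using assms
proof (induction i arbitrary: j)
  case (Suc i)
  then obtain j' where j: "j = Suc j'" "i \<le> j'" by (cases j) auto
  have "(\<integral>x. centred d i (shift x) * centred d j' (shift x) \<partial>\<mu>) = (\<integral>x. centred d i x * centred d j' x \<partial>\<mu>)"
    by (rule integral_shift) (intro measurable_continuous continuous_intros)
  with Suc.IH[OF j(2)] show ?case by (simp add: j(1) centred_def shift_def)
qed (simp add: correlation_def)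

lemma integral_centred_mult:
  "(\<integral>x. centred d i x * centred d j x \<partial>\<mu>) = (if i \<le> j then correlation (j - i) else correlation (i - j))"
  using integral_centred_mult_le[of i j] integral_centred_mult_le[of j i]
  by (simp add: mult.commute)

text \<open>Every coordinate has mean \<open>d\<close>, so the covariance is a joint probability
  minus \<open>d * d\<close>. This is the quantity that weak mixing controls for the event
  \<open>x 0\<close> paired with itself.\<close>

lemma correlation_eq:
  "correlation h = measure \<mu> ((shift ^^ h) -` {x\<in>X. x 0} \<inter> space \<mu> \<inter> {x\<in>X. x 0}) - d * d"
proof -
  have "shift x \<in> X" if "x \<in> X" for x
    using measurable_space[OF shift_measurable] that space_eq by auto
  then have "(shift ^^ n) x \<in> X" if "x \<in> X" for x n
    using that by (induction n) auto
  then have eq: "(shift ^^ h) -` {x\<in>X. x 0} \<inter> space \<mu> \<inter> {x\<in>X. x 0} = {x. x 0 \<and> x h} \<inter> space \<mu>"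
    by (auto simp: space_eq shift_funpow)
  have "correlation h = (\<integral>x. of_bool (x 0) * of_bool (x h) - d * of_bool (x 0) - d * of_bool (x h) + d * d \<partial>\<mu>)"
    unfolding correlation_def centred_def
    by (intro Bochner_Integration.integral_cong) (auto simp: algebra_simps)
  also have "\<dots> = (\<integral>x. of_bool (x 0) * of_bool (x h) \<partial>\<mu>) - d * d"
    using integrable_coordinates by (simp add: integral_coordinate prob_space)
  also have "(\<integral>x. of_bool (x 0) * of_bool (x h) \<partial>\<mu>) = (\<integral>x. (indicator {x. x 0 \<and> x h} x :: real) \<partial>\<mu>)"
    by (intro Bochner_Integration.integral_cong) (auto simp: indicator_def)
  also have "\<dots> = measure \<mu> ({x. x 0 \<and> x h} \<inter> space \<mu>)" by simp
  finally show ?thesis by (simp only: eq)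
qed

lemma correlation_tendsto: "(\<lambda>N. (\<Sum>h<N. \<bar>correlation h\<bar>) / real N) \<longlonglongrightarrow> 0"
proof -
  define E where "E = {x\<in>X. x 0}"
  have "(\<lambda>x. of_bool (x 0) :: real) -` {1} \<inter> space \<mu> \<in> sets \<mu>"
    by (rule measurable_sets[OF measurable_continuous[OF continuous_on_coordinate]]) simp
  also have "(\<lambda>x. of_bool (x 0) :: real) -` {1} \<inter> space \<mu> = E"
    by (auto simp: E_def space_eq)
  finally have E: "E \<in> sets \<mu>" .
  have "measure \<mu> E = (\<integral>x. indicator E x \<partial>\<mu>)" using E sets.sets_into_space by (simp add: Int_absorb2)
  also have "\<dots> = (\<integral>x. of_bool (x 0) \<partial>\<mu>)"
    by (intro Bochner_Integration.integral_cong) (auto simp: indicator_def E_def space_eq)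
  finally have "measure \<mu> E = d" by (simp add: integral_coordinate)
  then show ?thesis
    using weakly_mixing E correlation_eq unfolding weakly_mixing_def E_def by auto
qed

section \<open>Averages along multiples\<close>

text \<open>At \<open>(shift ^^ (q * j - 1)) (ind A)\<close> with \<open>q\<close> and
  \<open>j\<close> positive, coordinate \<open>q * h\<close> records whether
  \<open>q * (j + h)\<close> lies in \<open>A\<close>. The value there is the deviation from
  \<open>d\<close> of the density of \<open>A / q\<close> on the window of length \<open>H\<close>
  starting at \<open>j\<close>.\<close>

definition spread_average :: "nat \<Rightarrow> nat \<Rightarrow> omega \<Rightarrow> real" where
  "spread_average q H x = (\<Sum>h<H. centred d (q * h) x) / H"

lemma continuous_on_spread_average: "continuous_on S (\<lambda>x. (spread_average q H x)\<^sup>2)"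
  unfolding spread_average_def divide_inverse by (intro continuous_intros)

text \<open>Expanding the square gives correlations at the distances between \<open>q * h\<close>
  and \<open>q * h'\<close>. For fixed \<open>h\<close> these are distinct numbers below
  \<open>q * H\<close> on either side of the diagonal, so a row costs at most twice the sum over all
  \<open>j < q * H\<close>.\<close>

lemma integral_spread_average_le:
  assumes "q > 0"
  shows "(\<integral>x. (spread_average q H x)\<^sup>2 \<partial>\<mu>) \<le> 2 * (\<Sum>j<q * H. \<bar>correlation j\<bar>) / H"
proof -
  define C where "C = (\<Sum>j<q * H. \<bar>correlation j\<bar>)"
  have part: "(\<Sum>h'\<in>I. \<bar>correlation (f h')\<bar>) \<le> C"
    if "inj_on f I" "f ` I \<subseteq> {..<q * H}" for I f
    unfolding C_def using that
    by (subst sum.reindex[OF that(1), of "\<lambda>j. \<bar>correlation j\<bar>", unfolded comp_def, symmetric]) (auto intro!: sum_mono2)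
  have row: "(\<Sum>h'<H. \<integral>x. centred d (q * h) x * centred d (q * h') x \<partial>\<mu>) \<le> 2 * C" if "h < H" for h
  proof -
    have "(\<Sum>h'<H. \<integral>x. centred d (q * h) x * centred d (q * h') x \<partial>\<mu>)
        \<le> (\<Sum>h'<H. \<bar>if h \<le> h' then correlation (q * h' - q * h) else correlation (q * h - q * h')\<bar>)"
      using assms by (intro sum_mono) (simp add: integral_centred_mult)
    also have "\<dots> = (\<Sum>h'\<in>{..<h}. \<bar>correlation (q * h - q * h')\<bar>) + (\<Sum>h'\<in>{h..<H}. \<bar>correlation (q * h' - q * h)\<bar>)"
    proof -
      have "{..<H} = {..<h} \<union> {h..<H}" using that by auto
      then show ?thesis by (simp add: sum.union_disjoint ivl_disj_int)
    qed
    also have "\<dots> \<le> C + C"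
    proof (intro add_mono part)
      show "inj_on (\<lambda>h'. q * h - q * h') {..<h}" "inj_on (\<lambda>h'. q * h' - q * h) {h..<H}"
        using assms by (auto simp: inj_on_def simp flip: diff_mult_distrib2)
      show "(\<lambda>h'. q * h - q * h') ` {..<h} \<subseteq> {..<q * H}" "(\<lambda>h'. q * h' - q * h) ` {h..<H} \<subseteq> {..<q * H}"
        using assms that by (auto simp flip: diff_mult_distrib2)
    qed
    finally show ?thesis by simp
  qed
  have "(\<integral>x. (spread_average q H x)\<^sup>2 \<partial>\<mu>)
      = (\<integral>x. (\<Sum>h<H. \<Sum>h'<H. centred d (q * h) x * centred d (q * h') x) / (real H)\<^sup>2 \<partial>\<mu>)"
    by (simp add: spread_average_def power_divide power2_eq_square sum_product)
  also have "\<dots> = (\<Sum>h<H. \<Sum>h'<H. \<integral>x. centred d (q * h) x * centred d (q * h') x \<partial>\<mu>) / (real H)\<^sup>2"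
    by (simp add: integrable_centred_mult)
  also have "\<dots> \<le> (\<Sum>h<H. 2 * C) / (real H)\<^sup>2"
    using row by (intro divide_right_mono sum_mono) auto
  also have "\<dots> = 2 * C / H" by (simp add: power2_eq_square)
  finally show ?thesis by (simp add: C_def)
qed

lemma integral_spread_average_tendsto:
  assumes "q > 0"
  shows "(\<lambda>H. \<integral>x. (spread_average q H x)\<^sup>2 \<partial>\<mu>) \<longlonglongrightarrow> 0"
proof (rule tendsto_sandwich[OF _ _ tendsto_const])
  have "filterlim (\<lambda>H. q * H) sequentially sequentially"
    using assms by (intro filterlim_subseq) (auto simp: strict_mono_def)
  from filterlim_compose[OF correlation_tendsto this]
  \<comment> \<open>Normalising by \<open>q * H\<close> instead of \<open>H\<close> costs only the
    constant factor \<open>q\<close>.\<close>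
  have "(\<lambda>H. 2 * q * ((\<Sum>j<q * H. \<bar>correlation j\<bar>) / real (q * H))) \<longlonglongrightarrow> real (2 * q) * 0"
    by (intro tendsto_mult tendsto_const)
  then show "(\<lambda>H. 2 * (\<Sum>j<q * H. \<bar>correlation j\<bar>) / H) \<longlonglongrightarrow> 0"
    using assms by simp
qed (use assms integral_spread_average_le in auto)

text \<open>A positive proportion of the sets \<open>A / q\<close> share an element, since each of them has
  density \<open>d\<close>; this is proved through second moments, bounding the sum over the multiples of
  \<open>q\<close> by the sum over all integers.\<close>

lemma ex_common_dilate:
  assumes "finite Q" "Q \<noteq> {}" and Q_pos: "\<And>q. q \<in> Q \<Longrightarrow> q > 0"
  shows "\<exists>n>0. d / 2 * card Q \<le> card {q\<in>Q. q * n \<in> A}"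
proof (rule ccontr)
  assume "\<not> ?thesis"
  then have few: "real (card {q\<in>Q. q * n \<in> A}) < d / 2 * card Q" if "n > 0" for n
    using that by (meson not_le)
  have "card Q > 0" using assms by (simp add: card_gt_0_iff)
  \<comment> \<open>Balances the final count: \<open>card Q * \<eta>\<close> equals
    \<open>d\<^sup>2 / 4\<close>, the lower bound in \<open>row\<close>. The thresholds
    \<open>\<eta> / q\<close> below pay for summing over \<open>q * N\<close> shifts.\<close>
  define \<eta> where "\<eta> = d\<^sup>2 / (4 * card Q)"
  have "\<eta> > 0" using d_pos \<open>card Q > 0\<close> by (simp add: \<eta>_def)
  \<comment> \<open>As \<open>Q\<close> is finite, one \<open>H\<close> serves all \<open>q\<close>.
    It is fixed before \<open>N\<close>, since genericity applies to a fixed continuous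
    function.\<close>
  have "eventually (\<lambda>H. \<forall>q\<in>Q. (\<integral>x. (spread_average q H x)\<^sup>2 \<partial>\<mu>) < \<eta> / q) sequentially"
    using assms \<open>\<eta> > 0\<close>
    by (intro eventually_ball_finite ballI order_tendstoD(2)[OF integral_spread_average_tendsto]) auto
  then have "eventually (\<lambda>H. (\<forall>q\<in>Q. (\<integral>x. (spread_average q H x)\<^sup>2 \<partial>\<mu>) < \<eta> / q) \<and> H > 0) sequentially"
    by (intro eventually_conj eventually_gt_at_top)
  then obtain H where H: "\<And>q. q \<in> Q \<Longrightarrow> (\<integral>x. (spread_average q H x)\<^sup>2 \<partial>\<mu>) < \<eta> / q" "H > 0"
    by (auto simp: eventually_sequentially)
  define G where "G q n = (spread_average q H ((shift ^^ n) (ind A)))\<^sup>2" for q n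
  have "eventually (\<lambda>N. (\<Sum>n<q * N. G q n) / real (q * N) < \<eta> / q) sequentially" if "q \<in> Q" for q
  proof -
    have "filterlim (\<lambda>N. q * N) sequentially sequentially"
      using Q_pos[OF that] by (intro filterlim_subseq) (auto simp: strict_mono_def)
    from filterlim_compose[OF generic_tendsto[OF continuous_on_spread_average] this]
    show ?thesis unfolding G_def using H(1)[OF that] by (rule order_tendstoD(2))
  qed
  then have "eventually (\<lambda>N. (\<forall>q\<in>Q. (\<Sum>n<q * N. G q n) / real (q * N) < \<eta> / q) \<and> N > 0) sequentially"
    using assms by (intro eventually_conj eventually_ball_finite eventually_gt_at_top) auto
  then obtain N where N: "\<And>q. q \<in> Q \<Longrightarrow> (\<Sum>n<q * N. G q n) / real (q * N) < \<eta> / q" "N > 0"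
    by (auto simp: eventually_sequentially)
  \<comment> \<open>The place \<open>q * j - 1\<close> holds the number \<open>q * j\<close>.
    Squares are nonnegative, so the sum over these places is at most the sum over all
    \<open>n < q * N\<close>.\<close>
  have column: "(\<Sum>j\<in>{1..N}. G q (q * j - 1)) < \<eta> * N" if "q \<in> Q" for q
  proof -
    have "q > 0" by (rule Q_pos) fact
    have inj: "inj_on (\<lambda>j. q * j - 1) {1..N}"
      using \<open>q > 0\<close> by (auto simp: inj_on_def) (metis One_nat_def Suc_pred mult_left_cancel nat_0_less_mult_iff not_gr_zero Suc_le_eq)
    have sub: "(\<lambda>j. q * j - 1) ` {1..N} \<subseteq> {..<q * N}"
    proof
      fix n assume "n \<in> (\<lambda>j. q * j - 1) ` {1..N}"
      then obtain j where "1 \<le> j" "j \<le> N" "n = q * j - 1" by auto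
      moreover have "q * j \<le> q * N" "q * j > 0" using \<open>q > 0\<close> calculation by auto
      ultimately have "n < q * N" by linarith
      then show "n \<in> {..<q * N}" by simp
    qed
    have "(\<Sum>j\<in>{1..N}. G q (q * j - 1)) = (\<Sum>n\<in>(\<lambda>j. q * j - 1) ` {1..N}. G q n)"
      using inj by (simp add: sum.reindex)
    also have "\<dots> \<le> (\<Sum>n<q * N. G q n)"
      using sub by (intro sum_mono2) (auto simp: G_def)
    also have "\<dots> < \<eta> * N"
      using N(1)[OF that] \<open>N > 0\<close> \<open>q > 0\<close> by (simp add: field_simps)
    finally show ?thesis .
  qed
  \<comment> \<open>By \<open>few\<close>, each \<open>j + h\<close> has
    \<open>q * (j + h) \<in> A\<close> for fewer than \<open>d / 2 * card Q\<close> of the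
    \<open>q\<close>, so the deviations \<open>g q\<close> average below \<open>- (d / 2)\<close>.
    Some single \<open>g q\<close> is then that negative, and its square is at least
    \<open>d\<^sup>2 / 4\<close>.\<close>
  have row: "d\<^sup>2 / 4 \<le> (\<Sum>q\<in>Q. G q (q * j - 1))" if "j > 0" for j
  proof -
    define g where "g q = spread_average q H ((shift ^^ (q * j - 1)) (ind A))" for q
    have g: "g q = (\<Sum>h<H. of_bool (q * (j + h) \<in> A) - d) / H" if "q \<in> Q" for q
    proof -
      have "Suc (q * j - 1 + q * h) = q * (j + h)" for h
        using Q_pos[OF that] \<open>j > 0\<close> by (simp add: algebra_simps)
      then show ?thesis
        unfolding g_def spread_average_def centred_def shift_funpow ind_def by simp
    qed
    have "(\<Sum>q\<in>Q. g q) = (\<Sum>h<H. \<Sum>q\<in>Q. of_bool (q * (j + h) \<in> A) - d) / H"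
      unfolding sum.swap[of _ Q] by (simp add: g sum_divide_distrib[symmetric])
    also have "\<dots> < (\<Sum>h<H. - (d / 2 * card Q)) / H"
    proof (intro divide_strict_right_mono sum_strict_mono)
      fix h
      have "(\<Sum>q\<in>Q. of_bool (q * (j + h) \<in> A)) = real (card {q\<in>Q. q * (j + h) \<in> A})"
        using \<open>finite Q\<close> by (simp add: of_bool_def sum.If_cases Int_def)
      then show "(\<Sum>q\<in>Q. of_bool (q * (j + h) \<in> A) - d) < - (d / 2 * card Q)"
        using few[of "j + h"] \<open>j > 0\<close> by (simp add: sum_subtractf mult.commute)
    qed (use H(2) in auto)
    also have "\<dots> = (\<Sum>q\<in>Q. - (d / 2))" using H(2) by simp
    finally have lt: "(\<Sum>q\<in>Q. g q) < (\<Sum>q\<in>Q. - (d / 2))" .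
    obtain q where q: "q \<in> Q" "g q < - (d / 2)"
    proof (rule ccontr)
      assume "\<not> thesis"
      then have "(\<Sum>q\<in>Q. - (d / 2)) \<le> (\<Sum>q\<in>Q. g q)"
        using that by (intro sum_mono) (meson not_le)
      with lt show False by simp
    qed
    have "(d / 2)\<^sup>2 \<le> (- g q)\<^sup>2" using q(2) d_pos by (intro power_mono) auto
    also have "\<dots> = G q (q * j - 1)" by (simp add: G_def g_def)
    also have "\<dots> \<le> (\<Sum>q\<in>Q. G q (q * j - 1))"
      using q(1) \<open>finite Q\<close> by (intro member_le_sum) (auto simp: G_def)
    finally show ?thesis by (simp add: power_divide)
  qed
  \<comment> \<open>Double counting: the lower bounds over \<open>j\<close> and the upper bounds
    over \<open>q\<close> contradict each other.\<close>
  have "N * (d\<^sup>2 / 4) = (\<Sum>j\<in>{1..N}. d\<^sup>2 / 4)" by simp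
  also have "\<dots> \<le> (\<Sum>j\<in>{1..N}. \<Sum>q\<in>Q. G q (q * j - 1))" using row by (intro sum_mono) auto
  also have "\<dots> = (\<Sum>q\<in>Q. \<Sum>j\<in>{1..N}. G q (q * j - 1))" by (rule sum.swap)
  also have "\<dots> < (\<Sum>q\<in>Q. \<eta> * N)" using column assms by (intro sum_strict_mono) auto
  also have "\<dots> = N * (d\<^sup>2 / 4)" using \<open>card Q > 0\<close> by (simp add: \<eta>_def)
  finally show False by simp
qed

end

section \<open>Geometric progressions\<close>

theorem mainTheorem4:
  fixes A :: "nat set"
  assumes "0 \<notin> A" and "WM_set A"
  shows "\<exists>x\<in>A. \<exists>y\<in>A. \<exists>z\<in>A. x \<noteq> y \<and> x * y = z ^ 2"
proof -
  from assms(2) obtain \<mu> d where "wm_system \<mu> A d"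
    unfolding WM_set_def wm_system_def wm_system_axioms_def by blast
  then interpret wm_system \<mu> A d .
  \<comment> \<open>The threshold \<open>d / 2\<close> is the proportion that
    \<open>ex_common_dilate\<close> provides for a set of \<open>L\<close> multipliers.\<close>
  obtain L :: nat where "L > 0"
    and L: "\<forall>B\<subseteq>{0..<int L}. d / 2 * L \<le> card B \<longrightarrow> \<not> progression_free B"
    using roth[of "d / 2"] d_pos by (metis half_gt_zero)
  define Q :: "nat set" where "Q = (\<lambda>k. 2 ^ k) ` {..<L}"
  have inj: "inj (\<lambda>k. 2 ^ k :: nat)" by (simp add: inj_def)
  have "card Q = L" unfolding Q_def by (subst card_image) (auto intro: inj_on_subset[OF inj])
  obtain n where "n > 0" and n: "d / 2 * card Q \<le> card {q\<in>Q. q * n \<in> A}"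
  proof -
    have "finite Q" "Q \<noteq> {}" "\<And>q. q \<in> Q \<Longrightarrow> q > 0" using \<open>L > 0\<close> by (auto simp: Q_def)
    then show thesis using ex_common_dilate[of Q] that by blast
  qed
  define B where "B = int ` {k\<in>{..<L}. 2 ^ k * n \<in> A}"
  have "{q\<in>Q. q * n \<in> A} = (\<lambda>k. 2 ^ k) ` {k\<in>{..<L}. 2 ^ k * n \<in> A}" by (auto simp: Q_def)
  then have "card {q\<in>Q. q * n \<in> A} = card B"
    unfolding B_def by (simp add: card_image inj_on_subset[OF inj])
  then have "d / 2 * L \<le> card B" using n \<open>card Q = L\<close> by simp
  moreover have "B \<subseteq> {0..<int L}" by (auto simp: B_def)
  ultimately have "\<not> progression_free B" using L by blast
  then obtain i j l where ijl: "2 ^ i * n \<in> A" "2 ^ j * n \<in> A" "2 ^ l * n \<in> A"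
      "i + j = 2 * l" "i \<noteq> j"
    unfolding progression_free_def B_def by fastforce
  have "(2 ^ i * n) * (2 ^ j * n) = 2 ^ (i + j) * (n * n)" by (simp add: power_add)
  also have "\<dots> = (2 ^ l * n) ^ 2"
    by (simp add: ijl(4) power2_eq_square mult_2 power_add)
  finally have "(2 ^ i * n) * (2 ^ j * n) = (2 ^ l * n) ^ 2" .
  moreover have "2 ^ i * n \<noteq> 2 ^ j * n" using \<open>i \<noteq> j\<close> \<open>n > 0\<close> by simp
  ultimately show ?thesis using ijl(1-3) by blast
qed

end
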